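(* Let $G$ be an abelian group with at least one finite nontrivial proper subgroup. Let $\ell$ and $n$ be integers such that $\ell \ge 0$ and $n_0(G) \le n<|G|$. Then there exist subsets $A,B\subseteq G$ such that $1\notin B$, $|A|=|B|=n$, and $\delta(A,B) > \ell$ if and only if there is a subgroup $H$ of $G$ with $|H|\le n$ and $|H|\nmid (n+j)$ for all $j = 1, \ldots, \ell+1$.
   Context: The group $G$ (possibly infinite) is written multiplicatively with identity $1$. For a group $G$ with at least one finite nontrivial proper subgroup, $n_0(G)$ denotes the smallest size of a finite nontrivial proper subgroup of $G$. For nonempty finite $A,B \subseteq G$ with $|A|=|B|$, a partial matching of $(A,B)$ with defect $d$ is an injective map $f : A' \to B$, where $A' \subseteq A$ and $|A \setminus A'| = d$, such that $a f(a) \notin A$ for all $a \in A'$. The empty map (with $A' = \emptyset$) is allowed. The deficiency $\delta(A,B)$ is the smallest nonnegative integer $d$ such that $(A,B)$ has a partial matching with defect $d$. *)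

theory Defs
  imports "HOL-Algebra.Group"
begin

definition finite_nontrivial_proper_subgroup :: "'a set \<Rightarrow> ('a, 'b) monoid_scheme \<Rightarrow> bool" where
  "finite_nontrivial_proper_subgroup H G \<longleftrightarrow>
     subgroup H G \<and> finite H \<and> H \<noteq> {\<one>\<^bsub>G\<^esub>} \<and> H \<noteq> carrier G"

text \<open>The following is only meaningful if \<open>G\<close> has a finite nontrivial proper subgroup.\<close>

definition n0 :: "('a, 'b) monoid_scheme \<Rightarrow> nat" where
  "n0 G = (LEAST k. \<exists>H. finite_nontrivial_proper_subgroup H G \<and> card H = k)"

text \<open>A partial matching of \<open>(A, B)\<close> is given by its domain \<open>D \<subseteq> A\<close> and a total function \<open>f\<close>,
  of which only the restriction to \<open>D\<close> matters. The notions are meant for nonempty finite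
  \<open>A, B \<subseteq> carrier G\<close> of equal cardinality; in that case the empty map is a partial matching of
  defect \<open>card A\<close>, so the minimum defining the deficiency exists.\<close>

definition partial_matching ::
  "('a, 'b) monoid_scheme \<Rightarrow> 'a set \<Rightarrow> 'a set \<Rightarrow> 'a set \<Rightarrow> ('a \<Rightarrow> 'a) \<Rightarrow> nat \<Rightarrow> bool" where
  "partial_matching G A B D f d \<longleftrightarrow>
     D \<subseteq> A \<and> card (A - D) = d \<and> inj_on f D \<and> f ` D \<subseteq> B \<and>
     (\<forall>a\<in>D. a \<otimes>\<^bsub>G\<^esub> f a \<notin> A)"

definition deficiency :: "('a, 'b) monoid_scheme \<Rightarrow> 'a set \<Rightarrow> 'a set \<Rightarrow> nat" where
  "deficiency G A B = (LEAST d. \<exists>D f. partial_matching G A B D f d)"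

end

theory Submission
  imports Defs "HOL-Algebra.Coset"
begin

text \<open>By the defect form of Hall's theorem, \<open>\<delta>(A, B) > l\<close> means that there are \<open>S \<subseteq> A\<close> and \<open>U \<subseteq> B\<close> with
  \<open>SU \<subseteq> A\<close> and \<open>|S| + |U| > n + l\<close>. Put \<open>V = U \<union> {1}\<close>; then still \<open>SV \<subseteq> A\<close>, and a weak form of Kneser's
  theorem gives a finite subgroup \<open>H\<close> with \<open>SVH = SV\<close> and \<open>|SV| + |H| \<ge> |S| + |V| \<ge> n + l + 2\<close>. As
  \<open>|SV| \<le> n\<close> is a multiple of \<open>|H|\<close>, the numbers \<open>n + 1, \<dots>, n + l + 1\<close> lie strictly between two
  consecutive multiples of \<open>|H|\<close>. Conversely, given \<open>H\<close>, take for \<open>S\<close> a union of \<open>n div |H|\<close> cosets of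
  \<open>H\<close>, let \<open>U = H - {1}\<close>, and extend \<open>S\<close> and \<open>U\<close> to sets of size \<open>n\<close>.

  The weak Kneser theorem is proved locally, for a subset of \<open>SV\<close> containing a given product, by Dyson's
  transform; the local subsets are then merged, since the bound \<open>|X| + |H| \<ge> m\<close> for \<open>H\<close>-periodic \<open>X\<close>
  survives unions if the two subgroups are replaced by their intersection.\<close>

section \<open>The defect form of Hall's theorem\<close>

text \<open>A nonempty proper subset that attains the bound takes the whole defect \<open>d\<close>,
  and the rest of \<open>A\<close> is matched completely outside its neighbourhood. If there is
  none, remove any \<open>a\<close>: either it has no neighbour and uses up one unit of defect, or
  it is matched to an arbitrary \<open>b\<close>. In both cases the strict inequality for the
  remaining subsets pays for the lost unit.\<close>

lemma Hall_defect:
  fixes N :: "'a \<Rightarrow> 'b set"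
  assumes "finite A" and "\<And>a. a \<in> A \<Longrightarrow> finite (N a)"
    and "\<And>S. S \<subseteq> A \<Longrightarrow> card S \<le> card (\<Union>(N ` S)) + d"
  shows "\<exists>D f. D \<subseteq> A \<and> card (A - D) \<le> d \<and> inj_on f D \<and> (\<forall>a\<in>D. f a \<in> N a)"
  using assms
proof (induction "card A" arbitrary: A N d rule: less_induct)
  case less
  note finA = \<open>finite A\<close> and finN = less.prems(2) and hall = less.prems(3)
  have finU: "finite (\<Union>(N ` S))" if "S \<subseteq> A" for S
    using that finA finN by (meson finite_UN finite_subset subsetD)
  consider (empty) "A = {}"
    | (tight) S where "S \<subseteq> A" "S \<noteq> {}" "S \<noteq> A" "card S = card (\<Union>(N ` S)) + d"
    | (slack) "A \<noteq> {}" "\<And>S. S \<subseteq> A \<Longrightarrow> S \<noteq> {} \<Longrightarrow> S \<noteq> A \<Longrightarrow> card S < card (\<Union>(N ` S)) + d"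
    using hall by (meson le_neq_implies_less)
  then show ?case
  proof cases
    case empty
    then show ?thesis by auto
  next
    case tight
    define N' where "N' a = N a - \<Union>(N ` S)" for a
    have finS: "finite S" using tight finA finite_subset by blast
    have "card S < card A" using tight finA by (intro psubset_card_mono) auto
    moreover have "card T \<le> card (\<Union>(N ` T)) + d" if "T \<subseteq> S" for T
      using hall that tight by blast
    ultimately obtain D f where D: "D \<subseteq> S" "card (S - D) \<le> d" "inj_on f D" "\<forall>a\<in>D. f a \<in> N a"
      using less.hyps[of S N d] finS finN tight(1) by (meson subsetD)
    have "card (A - S) < card A"
      using tight finA by (intro psubset_card_mono) auto
    moreover have "card T \<le> card (\<Union>(N' ` T)) + 0" if "T \<subseteq> A - S" for T
    proof -
      have finT: "finite T" using that finA finite_subset by blast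
      have "card S + card T = card (S \<union> T)"
        using that finS finT by (subst card_Un_disjoint) auto
      also have "\<dots> \<le> card (\<Union>(N ` (S \<union> T))) + d"
        using that tight by (intro hall) auto
      also have "\<Union>(N ` (S \<union> T)) = \<Union>(N ` S) \<union> \<Union>(N' ` T)" by (auto simp: N'_def)
      also have "card \<dots> \<le> card (\<Union>(N ` S)) + card (\<Union>(N' ` T))" by (rule card_Un_le)
      finally show ?thesis using tight by simp
    qed
    ultimately obtain D' f' where
      D': "D' \<subseteq> A - S" "card (A - S - D') \<le> 0" "inj_on f' D'" "\<forall>a\<in>D'. f' a \<in> N' a"
      using less.hyps[of "A - S" N' 0] finA finN by (metis N'_def DiffE finite_Diff)
    define g where "g a = (if a \<in> S then f a else f' a)" for a
    have "D' = A - S" using D' finA by simp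
    then have "A - (D \<union> D') = S - D" using tight(1) D(1) by auto
    moreover have "inj_on g (D \<union> D')"
    proof -
      have "inj_on g D" using D(1,3) by (subst inj_on_cong[of D g f]) (auto simp: g_def)
      moreover have "inj_on g D'" using D'(1,3) by (subst inj_on_cong[of D' g f']) (auto simp: g_def)
      moreover have "g ` D \<subseteq> \<Union>(N ` S)" using D by (auto simp: g_def)
      moreover have "g ` D' \<inter> \<Union>(N ` S) = {}" using D' by (auto simp: g_def N'_def)
      ultimately show ?thesis unfolding inj_on_Un by blast
    qed
    moreover have "\<forall>a\<in>D \<union> D'. g a \<in> N a"
      using D D' by (auto simp: g_def N'_def)
    ultimately show ?thesis using D D' tight(1)
      by (intro exI[of _ "D \<union> D'"] exI[of _ g]) auto
  next
    case slack
    then obtain a where a: "a \<in> A" by blast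
    have less: "card (A - {a}) < card A" using a finA by (rule card_Diff1_less[rotated])
    show ?thesis
    proof (cases "N a = {}")
      case True
      then have "d \<ge> 1" using hall[of "{a}"] a by simp
      have "card S \<le> card (\<Union>(N ` S)) + (d - 1)" if "S \<subseteq> A - {a}" for S
      proof (cases "S = {}")
        case False
        then show ?thesis using slack(2)[of S] that a \<open>d \<ge> 1\<close> by fastforce
      qed simp
      then obtain D f where D: "D \<subseteq> A - {a}" "card (A - {a} - D) \<le> d - 1" "inj_on f D" "\<forall>a\<in>D. f a \<in> N a"
        using less.hyps[OF less, of N "d - 1"] finA finN by auto
      have "A - D = insert a (A - {a} - D)" using a D by auto
      then have "card (A - D) \<le> d" using D \<open>d \<ge> 1\<close> finA by (simp add: card_insert_if)
      then show ?thesis using D by blast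
    next
      case False
      then obtain b where b: "b \<in> N a" by blast
      define N' where "N' x = N x - {b}" for x
      have "card S \<le> card (\<Union>(N' ` S)) + d" if "S \<subseteq> A - {a}" for S
      proof (cases "S = {}")
        case False
        then have "card S < card (\<Union>(N ` S)) + d" using slack(2)[of S] that a by blast
        moreover have "\<Union>(N' ` S) = \<Union>(N ` S) - {b}" by (auto simp: N'_def)
        ultimately show ?thesis using card_Diff1_le[of "\<Union>(N ` S)" b] finU[of S] that
          by (auto simp: card_Diff_singleton_if)
      qed simp
      then obtain D f where D: "D \<subseteq> A - {a}" "card (A - {a} - D) \<le> d" "inj_on f D" "\<forall>a\<in>D. f a \<in> N' a"
        using less.hyps[OF less, of N' d] finA finN by (auto simp: N'_def)
      have "A - insert a D = A - {a} - D" by auto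
      moreover have "inj_on (f(a := b)) (insert a D)"
        using D by (auto simp: N'_def inj_on_def)
      ultimately show ?thesis using D a b
        by (intro exI[of _ "insert a D"] exI[of _ "f(a := b)"]) (auto simp: N'_def)
    qed
  qed
qed

lemma ex_superset_card:
  assumes "X \<subseteq> C" "finite X" "card X \<le> n" "infinite C \<or> n \<le> card C"
  shows "\<exists>Y. X \<subseteq> Y \<and> Y \<subseteq> C \<and> finite Y \<and> card Y = n"
proof -
  obtain Z where "Z \<subseteq> C - X" "finite Z" "card Z = n - card X"
  proof (cases "finite C")
    case True
    then have "n - card X \<le> card (C - X)" using assms by (simp add: card_Diff_subset)
    then show ?thesis using that True obtain_subset_with_card_n by (metis finite_Diff finite_subset)
  next
    case False
    then have "infinite (C - X)" using assms by simp
    then show ?thesis using that infinite_arbitrarily_large by blast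
  qed
  moreover from this have "card (X \<union> Z) = n"
    using assms by (subst card_Un_disjoint) auto
  ultimately show ?thesis using assms by (intro exI[of _ "X \<union> Z"]) auto
qed

section \<open>A weak form of Kneser's theorem\<close>

text \<open>For a subgroup \<open>H\<close> of a group and \<open>X\<close> inside its carrier:
  \<open>X\<close> is a union of cosets of \<open>H\<close>.\<close>

definition (in monoid) periodic :: "'a set \<Rightarrow> 'a set \<Rightarrow> bool" where
  "periodic X H \<longleftrightarrow> (\<forall>x\<in>X. \<forall>h\<in>H. x \<otimes> h \<in> X)"

text \<open>Kneser's inequality with \<open>m\<close> in place of |A| + |B|. It allows any set and
  any finite subgroup of periods, so that it can be proved for parts of a product set and then
  merged.\<close>

definition (in monoid) kneser_bound :: "nat \<Rightarrow> 'a set \<Rightarrow> bool" where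
  "kneser_bound m X \<longleftrightarrow>
     (\<exists>H. subgroup H G \<and> finite H \<and> periodic X H \<and> m \<le> card X + card H)"

context comm_group
begin

section \<open>Periodic sets and their unions\<close>

lemma periodic_mult_iff:
  assumes "subgroup H G" "periodic X H" "h \<in> H" "x \<in> carrier G"
  shows "x \<otimes> h \<in> X \<longleftrightarrow> x \<in> X"
proof
  have h: "h \<in> carrier G" "inv h \<in> H"
    using assms by (auto dest: subgroup.mem_carrier subgroup.m_inv_closed)
  assume "x \<otimes> h \<in> X"
  then have "(x \<otimes> h) \<otimes> inv h \<in> X" using h assms unfolding periodic_def by blast
  then show "x \<in> X" using h assms by (simp add: m_assoc)
qed (use assms in \<open>auto simp: periodic_def\<close>)

lemma card_subgroup_dvd_periodic:
  assumes "subgroup H G" "periodic X H" "X \<subseteq> carrier G" "finite X"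
  shows "card H dvd card X"
proof -
  interpret subgroup H G by fact
  let ?P = "(\<lambda>x. H #> x) ` X"
  have "H #> x \<subseteq> X" if "x \<in> X" for x
    using that assms unfolding periodic_def r_coset_def by (auto simp: m_comm subset_iff)
  moreover have "x \<in> H #> x" if "x \<in> X" for x
    using that assms by (intro rcos_self) auto
  ultimately have X: "\<Union>?P = X" by blast
  have P: "?P \<subseteq> rcosets H" using assms by (auto simp: RCOSETS_def)
  have "card H dvd card (\<Union>?P)"
  proof (rule dvd_partition)
    show "\<forall>c\<in>?P. card H dvd card c"
      using P card_rcosets_equal[OF _ subset] by (metis dvd_refl subsetD)
    show "\<forall>c1\<in>?P. \<forall>c2\<in>?P. c1 \<noteq> c2 \<longrightarrow> c1 \<inter> c2 = {}"
      using pairwise_subset[OF rcos_disjoint[OF assms(1)] P] by (simp add: pairwise_def disjnt_def)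
  qed (use X assms in auto)
  then show ?thesis by (simp only: X)
qed

text \<open>Both sets on the left, translated by \<open>x\<close>, are contained in \<open>Y - X\<close>, and they overlap only inside \<open>H \<inter> K\<close>.\<close>

lemma card_Diff_periodic_ge:
  assumes H: "subgroup H G" "periodic X H" and K: "subgroup K G" "finite K" "periodic Y K"
    and "finite H" "finite Y" "x \<in> Y - X" "x \<in> carrier G"
  shows "card {g \<in> H. x \<otimes> g \<in> Y} + card {g \<in> K. x \<otimes> g \<notin> X} \<le> card (Y - X) + card (H \<inter> K)"
proof -
  let ?P = "{g \<in> H. x \<otimes> g \<in> Y}" and ?Q = "{g \<in> K. x \<otimes> g \<notin> X}"
  have sub: "H \<subseteq> carrier G" "K \<subseteq> carrier G" using H K by (auto dest: subgroup.subset)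
  have "card ?P + card ?Q = card (?P \<union> ?Q) + card (?P \<inter> ?Q)"
    using assms by (intro card_Un_Int) auto
  moreover have "card (?P \<inter> ?Q) \<le> card (H \<inter> K)" using assms by (intro card_mono) auto
  moreover have "card (?P \<union> ?Q) \<le> card (Y - X)"
  proof (rule card_inj_on_le)
    show "inj_on ((\<otimes>) x) (?P \<union> ?Q)"
      using sub assms by (intro inj_onI) (auto simp: subset_iff)
    show "(\<otimes>) x ` (?P \<union> ?Q) \<subseteq> Y - X"
      using assms periodic_mult_iff[OF H] periodic_mult_iff[OF K(1,3)] by auto
  qed (use assms in auto)
  ultimately show ?thesis by linarith
qed

text \<open>Multiplication by \<open>inv k\<close> permutes \<open>K\<close> and carries the first
  set into the second. It serves to compare counts at \<open>x\<close> with counts at xhk.\<close>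

lemma card_translate_filter:
  assumes "subgroup K G" "finite K" "k \<in> K" "x \<in> carrier G" "y \<in> carrier G"
    and "\<And>g. g \<in> K \<Longrightarrow> x \<otimes> k \<otimes> g \<in> X \<Longrightarrow> y \<otimes> g \<in> X'"
  shows "card {g \<in> K. x \<otimes> g \<in> X} \<le> card {g \<in> K. y \<otimes> g \<in> X'}"
proof (rule card_inj_on_le)
  interpret subgroup K G by fact
  show "inj_on ((\<otimes>) (inv k)) {g \<in> K. x \<otimes> g \<in> X}"
    using assms by (intro inj_onI) auto
  show "(\<otimes>) (inv k) ` {g \<in> K. x \<otimes> g \<in> X} \<subseteq> {g \<in> K. y \<otimes> g \<in> X'}"
  proof safe
    fix g assume "g \<in> K" "x \<otimes> g \<in> X"
    moreover from this have "x \<otimes> k \<otimes> (inv k \<otimes> g) = x \<otimes> g"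
      using assms by (simp add: m_assoc inv_solve_left flip: m_assoc[of k "inv k" g])
    ultimately show "y \<otimes> (inv k \<otimes> g) \<in> X'" using assms by simp
  qed (use assms in auto)
qed (use assms in auto)

text \<open>The bound of the previous lemma at \<open>x\<close> is added to the one at \<open>xhk \<in> X - Y\<close>, with the roles of the
  two sets exchanged; the sets counted at \<open>xhk\<close> are complementary to those counted at \<open>x\<close>.\<close>

lemma card_Diff_periodic_add_ge:
  assumes H: "subgroup H G" "finite H" "periodic X H" and K: "subgroup K G" "finite K" "periodic Y K"
    and X: "finite X" "X \<subseteq> carrier G" and Y: "finite Y" "Y \<subseteq> carrier G"
    and x: "x \<in> Y - X" and h: "h \<in> H" "x \<otimes> h \<notin> Y" and k: "k \<in> K" "x \<otimes> k \<in> X"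
  shows "card H + card K \<le> card (Y - X) + card (X - Y) + 2 * card (H \<inter> K)"
proof -
  have carr: "x \<in> carrier G" "h \<in> carrier G" "k \<in> carrier G"
    using assms by (auto dest: subgroup.mem_carrier)
  have sub: "H \<subseteq> carrier G" "K \<subseteq> carrier G" using H K by (auto dest: subgroup.subset)
  have swap: "x \<otimes> h \<otimes> k \<otimes> g = x \<otimes> h \<otimes> g \<otimes> k" "x \<otimes> h \<otimes> k \<otimes> g = x \<otimes> k \<otimes> g \<otimes> h"
    if "g \<in> carrier G" for g
    using that carr by (simp_all add: m_ac)
  have inX: "x \<otimes> h \<otimes> k \<otimes> g \<in> X \<longleftrightarrow> x \<otimes> k \<otimes> g \<in> X" if "g \<in> carrier G" for g
    using periodic_mult_iff[OF H(1,3) h(1)] that carr by (simp add: swap(2))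
  have inY: "x \<otimes> h \<otimes> k \<otimes> g \<in> Y \<longleftrightarrow> x \<otimes> h \<otimes> g \<in> Y" if "g \<in> carrier G" for g
    using periodic_mult_iff[OF K(1,3) k(1)] that carr by (simp add: swap(1))
  have "card {g \<in> H. x \<otimes> g \<in> Y} + card {g \<in> K. x \<otimes> g \<notin> X} \<le> card (Y - X) + card (H \<inter> K)"
    using assms carr by (intro card_Diff_periodic_ge) auto
  \<comment> \<open>The instances of \<open>inX\<close> and \<open>inY\<close> at the identity put
    xhk in \<open>X - Y\<close>.\<close>
  moreover have "card {g \<in> K. x \<otimes> h \<otimes> k \<otimes> g \<in> X} + card {g \<in> H. x \<otimes> h \<otimes> k \<otimes> g \<notin> Y}
      \<le> card (X - Y) + card (K \<inter> H)"
    using assms carr inX[of \<one>] inY[of \<one>] by (intro card_Diff_periodic_ge) auto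
  moreover have "card {g \<in> K. x \<otimes> g \<in> X} \<le> card {g \<in> K. x \<otimes> h \<otimes> k \<otimes> g \<in> X}"
    using K k carr sub inX by (intro card_translate_filter[where k = k]) auto
  moreover have "card {g \<in> H. x \<otimes> g \<in> - Y} \<le> card {g \<in> H. x \<otimes> h \<otimes> k \<otimes> g \<in> - Y}"
    using H h carr sub inY by (intro card_translate_filter[where k = h]) auto
  moreover have "card {g \<in> H. x \<otimes> g \<in> Y} + card {g \<in> H. x \<otimes> g \<notin> Y} = card H"
    using H by (subst card_Un_disjoint[symmetric]) (auto intro: arg_cong[where f = card])
  moreover have "card {g \<in> K. x \<otimes> g \<in> X} + card {g \<in> K. x \<otimes> g \<notin> X} = card K"
    using K by (subst card_Un_disjoint[symmetric]) (auto intro: arg_cong[where f = card])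
  ultimately show ?thesis by (simp add: Int_commute)
qed

text \<open>This lets \<open>H\<close> or \<open>K\<close> shrink to \<open>H \<inter> K\<close> on
  passing to \<open>X \<union> Y\<close>: the added elements make up for the smaller subgroup. It is
  enough to prove the sum of the two inequalities, since it would fail if both did.\<close>

lemma card_Diff_periodic_cases:
  assumes H: "subgroup H G" "finite H" "periodic X H" and K: "subgroup K G" "finite K" "periodic Y K"
    and X: "finite X" "X \<subseteq> carrier G" and Y: "finite Y" "Y \<subseteq> carrier G"
    and "\<not> X \<subseteq> Y" "\<not> Y \<subseteq> X"
  shows "card H \<le> card (Y - X) + card (H \<inter> K) \<or> card K \<le> card (X - Y) + card (H \<inter> K)"
proof -
  obtain x y where x: "x \<in> Y - X" and y: "y \<in> X - Y" using assms by blast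
  have ge_x: "card {g \<in> H. z \<otimes> g \<in> Y} + card {g \<in> K. z \<otimes> g \<notin> X} \<le> card (Y - X) + card (H \<inter> K)"
    if "z \<in> Y - X" for z
    using that assms by (intro card_Diff_periodic_ge) auto
  have ge_y: "card {g \<in> K. z \<otimes> g \<in> X} + card {g \<in> H. z \<otimes> g \<notin> Y} \<le> card (X - Y) + card (H \<inter> K)"
    if "z \<in> X - Y" for z
    using that assms card_Diff_periodic_ge[of K Y H X z] by (auto simp: Int_commute)
  \<comment> \<open>In \<open>full\<close>, xH lies in \<open>Y\<close> or yK lies in
    \<open>X\<close>, and the count at that point already contains all of \<open>H\<close> or
    \<open>K\<close>. The other three cases yield the sum of the two inequalities.\<close>
  consider (full) "{g \<in> H. x \<otimes> g \<notin> Y} = {} \<or> {g \<in> K. y \<otimes> g \<notin> X} = {}"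
    | (disj) "{g \<in> K. x \<otimes> g \<in> X} = {}" "{g \<in> H. y \<otimes> g \<in> Y} = {}"
    | (x) h k where "h \<in> H" "x \<otimes> h \<notin> Y" "k \<in> K" "x \<otimes> k \<in> X"
    | (y) h k where "h \<in> H" "y \<otimes> h \<in> Y" "k \<in> K" "y \<otimes> k \<notin> X"
    by blast
  then show ?thesis
  proof cases
    case full
    then have "{g \<in> H. x \<otimes> g \<in> Y} = H \<or> {g \<in> K. y \<otimes> g \<in> X} = K" by blast
    then show ?thesis using ge_x[OF x] ge_y[OF y] by auto
  next
    case disj
    then have "{g \<in> K. x \<otimes> g \<notin> X} = K" "{g \<in> H. y \<otimes> g \<notin> Y} = H" by auto
    then show ?thesis using ge_x[OF x] ge_y[OF y] by (simp only:) linarith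
  next
    case x
    then show ?thesis
      using card_Diff_periodic_add_ge[OF H K X Y \<open>x \<in> Y - X\<close>, of h k] by auto
  next
    case y
    then show ?thesis
      using card_Diff_periodic_add_ge[OF K H Y X \<open>y \<in> X - Y\<close>, of k h] by (auto simp: Int_commute)
  qed
qed

lemma kneser_bound_Un:
  assumes X: "finite X" "X \<subseteq> carrier G" and Y: "finite Y" "Y \<subseteq> carrier G"
    and "kneser_bound m X" "kneser_bound m Y"
  shows "kneser_bound m (X \<union> Y)"
proof -
  consider "X \<union> Y = X" | "X \<union> Y = Y" | "\<not> X \<subseteq> Y" "\<not> Y \<subseteq> X" by blast
  then show ?thesis
  proof cases
    case 3
    obtain H where H: "subgroup H G" "finite H" "periodic X H" "m \<le> card X + card H"
      using assms unfolding kneser_bound_def by blast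
    obtain K where K: "subgroup K G" "finite K" "periodic Y K" "m \<le> card Y + card K"
      using assms unfolding kneser_bound_def by blast
    have "card (X \<union> Y) = card X + card (Y - X)"
      using X Y card_Un_disjoint[of X "Y - X"] by auto
    moreover have "card (X \<union> Y) = card Y + card (X - Y)"
      using X Y card_Un_disjoint[of Y "X - Y"] by (auto simp: Un_commute)
    ultimately have "m \<le> card (X \<union> Y) + card (H \<inter> K)"
      using card_Diff_periodic_cases[OF H(1-3) K(1-3) X Y 3] H(4) K(4) by linarith
    moreover have "periodic (X \<union> Y) (H \<inter> K)" using H K unfolding periodic_def by auto
    ultimately show ?thesis
      using H K subgroups_Inter_pair unfolding kneser_bound_def by blast
  qed (use assms in auto)
qed

lemma kneser_bound_Union:
  assumes "finite F" "F \<noteq> {}" "\<And>X. X \<in> F \<Longrightarrow> finite X \<and> X \<subseteq> carrier G \<and> kneser_bound m X"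
  shows "kneser_bound m (\<Union>F)"
  using assms
proof (induction F rule: finite_ne_induct)
  case (insert X F)
  then show ?case using kneser_bound_Un[of X "\<Union>F" m] by auto
qed auto

section \<open>Dyson's transform\<close>

lemma subgroup_stabilizer:
  assumes "finite A" "A \<subseteq> carrier G"
  shows "subgroup {g \<in> carrier G. \<forall>a\<in>A. a \<otimes> g \<in> A} G" (is "subgroup ?H G")
proof (rule subgroupI)
  have "\<one> \<in> ?H" using assms by auto
  then show "?H \<noteq> {}" by blast
next
  fix g assume "g \<in> ?H"
  then have g: "g \<in> carrier G" "(\<lambda>a. a \<otimes> g) ` A \<subseteq> A" by auto
  have "inj_on (\<lambda>a. a \<otimes> g) A"
    using g(1) assms(2) by (intro inj_onI) (auto simp: subset_iff)
  \<comment> \<open>An injective translation of the finite set \<open>A\<close> into itself is onto,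
    so translation by \<open>inv g\<close> also preserves \<open>A\<close>.\<close>
  then have surj: "(\<lambda>a. a \<otimes> g) ` A = A" by (rule endo_inj_surj[OF assms(1) g(2)])
  have "a \<otimes> inv g \<in> A" if "a \<in> A" for a
  proof -
    have "a \<in> (\<lambda>a. a \<otimes> g) ` A" using surj that by simp
    then obtain b where b: "b \<in> A" "a = b \<otimes> g" by (elim imageE)
    then have "b \<in> carrier G" using assms by auto
    then show ?thesis using b g(1) by (simp add: m_assoc)
  qed
  then show "inv g \<in> ?H" using g(1) by simp
next
  fix g h assume gh: "g \<in> ?H" "h \<in> ?H"
  have "a \<otimes> (g \<otimes> h) \<in> A" if "a \<in> A" for a
  proof -
    have "a \<in> carrier G" using that assms by auto
    then have "a \<otimes> (g \<otimes> h) = (a \<otimes> g) \<otimes> h" using gh by (simp add: m_assoc)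
    then show ?thesis using gh that by simp
  qed
  then show "g \<otimes> h \<in> ?H" using gh by simp
qed auto

text \<open>Dyson's transform replaces \<open>(A, B)\<close> by \<open>(A \<union> Bg, B \<inter> Ag\<^sup>-\<^sup>1)\<close> with \<open>g = e b\<^sup>-\<^sup>1\<close>, \<open>e \<in> A\<close>.
  It keeps the sum of the sizes, and the product set does not grow. If no choice of \<open>e\<close> shrinks \<open>B\<close>,
  then \<open>B b\<^sup>-\<^sup>1\<close> lies in the stabilizer of \<open>A\<close>.\<close>

lemma kneser_bound_local:
  assumes "finite A" "finite B" "A \<subseteq> carrier G" "B \<subseteq> carrier G" "a \<in> A" "b \<in> B"
  shows "\<exists>X. X \<subseteq> A <#> B \<and> a \<otimes> b \<in> X \<and> kneser_bound (card A + card B) X"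
  using assms
proof (induction "card B" arbitrary: A B rule: less_induct)
  case less
  note fin = less.prems(1,2) and sub = less.prems(3,4) and ab = less.prems(5,6)
  have carr: "a \<in> carrier G" "b \<in> carrier G" using ab sub by auto
  show ?case
  proof (cases "\<forall>e\<in>A. \<forall>x\<in>B. x \<otimes> (e \<otimes> inv b) \<in> A")
    case True
    define H where "H = {g \<in> carrier G. \<forall>a\<in>A. a \<otimes> g \<in> A}"
    \<comment> \<open>A translate of \<open>A\<close> has the same size and the same periods, and
      this one contains \<open>a \<otimes> b\<close>.\<close>
    define X where "X = (\<lambda>x. x \<otimes> b) ` A"
    have H: "subgroup H G" unfolding H_def using fin sub by (intro subgroup_stabilizer)
    have finH: "finite H"
    proof (rule inj_on_finite)
      show "inj_on ((\<otimes>) a) H" using carr by (intro inj_onI) (auto simp: H_def)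
      show "(\<otimes>) a ` H \<subseteq> A" using ab by (auto simp: H_def)
    qed (use fin in auto)
    have "card B \<le> card H"
    proof (rule card_inj_on_le)
      show "inj_on (\<lambda>x. x \<otimes> inv b) B"
        using sub carr by (intro inj_onI) (auto simp: subset_iff)
      show "(\<lambda>x. x \<otimes> inv b) ` B \<subseteq> H"
      proof (clarsimp simp: H_def, intro conjI ballI)
        fix x assume x: "x \<in> B"
        then have xc: "x \<in> carrier G" using sub by auto
        then show "x \<otimes> inv b \<in> carrier G" using carr by simp
        fix e assume e: "e \<in> A"
        then have "e \<in> carrier G" using sub by auto
        then have "e \<otimes> (x \<otimes> inv b) = x \<otimes> (e \<otimes> inv b)" using xc carr by (simp add: m_ac)
        then show "e \<otimes> (x \<otimes> inv b) \<in> A" using True x e by simp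
      qed
    qed (use finH in auto)
    moreover have "card X = card A"
      unfolding X_def using sub carr by (intro card_image inj_onI) (auto simp: subset_iff)
    moreover have "periodic X H"
    proof -
      have "x \<otimes> b \<otimes> h \<in> X" if "x \<in> A" "h \<in> H" for x h
      proof -
        have "x \<in> carrier G" "h \<in> carrier G" using that sub by (auto simp: H_def)
        then have "x \<otimes> b \<otimes> h = x \<otimes> h \<otimes> b" using carr by (simp add: m_ac)
        then show ?thesis using that by (auto simp: X_def H_def)
      qed
      then show ?thesis by (auto simp: periodic_def X_def)
    qed
    ultimately have "kneser_bound (card A + card B) X"
      using H finH unfolding kneser_bound_def by auto
    moreover have "X \<subseteq> A <#> B" "a \<otimes> b \<in> X" using ab by (auto simp: X_def set_mult_def)
    ultimately show ?thesis by blast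
  next
    case False
    then obtain e x where e: "e \<in> A" and x: "x \<in> B" "x \<otimes> (e \<otimes> inv b) \<notin> A" by blast
    define g where "g = e \<otimes> inv b"
    have ec: "e \<in> carrier G" using e sub by auto
    have g: "g \<in> carrier G" using ec carr by (simp add: g_def)
    have inj: "inj_on (\<lambda>x. x \<otimes> g) B"
      using sub g by (intro inj_onI) (auto simp: subset_iff)
    define A' B' where "A' = A \<union> (\<lambda>x. x \<otimes> g) ` B" and "B' = {x \<in> B. x \<otimes> g \<in> A}"
    \<comment> \<open>The choice of \<open>g\<close> sends \<open>b\<close> into \<open>A\<close>,
      so \<open>b\<close> survives in \<open>B'\<close> and the induction hypothesis still applies
      to the product \<open>a \<otimes> b\<close>.\<close>
    have "b \<otimes> g = e" using ec carr by (simp add: g_def m_lcomm[of b e])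
    then have b: "b \<in> B'" using ab e by (simp add: B'_def)
    have "card B' < card B"
      using x fin by (intro psubset_card_mono) (auto simp: B'_def g_def)
    then obtain X where X: "X \<subseteq> A' <#> B'" "a \<otimes> b \<in> X" "kneser_bound (card A' + card B') X"
      using less.hyps[of B' A'] fin sub ab b g by (auto simp: A'_def B'_def)
    have "A' <#> B' \<subseteq> A <#> B"
    proof -
      have "x \<otimes> g \<otimes> y \<in> A <#> B" if "x \<in> B" "y \<in> B'" for x y
      proof -
        have "x \<in> carrier G" "y \<in> carrier G" using that sub by (auto simp: B'_def)
        \<comment> \<open>The roles of \<open>x\<close> and \<open>y\<close> are exchanged:
          \<open>y \<otimes> g\<close> lies in \<open>A\<close> because
          \<open>y \<in> B'\<close>.\<close>
        then have "x \<otimes> g \<otimes> y = y \<otimes> g \<otimes> x" using g by (simp add: m_ac)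
        then show ?thesis using that by (auto simp: B'_def set_mult_def)
      qed
      then show ?thesis by (auto simp: A'_def B'_def set_mult_def)
    qed
    moreover have "card A' + card B' = card A + card B"
    proof -
      have "A \<inter> (\<lambda>x. x \<otimes> g) ` B = (\<lambda>x. x \<otimes> g) ` B'" by (auto simp: B'_def)
      then have "card (A \<inter> (\<lambda>x. x \<otimes> g) ` B) = card B'"
        using card_image[OF inj_on_subset[OF inj]] by (simp add: B'_def)
      then show ?thesis
        using card_Un_Int[of A "(\<lambda>x. x \<otimes> g) ` B"] fin card_image[OF inj] by (simp add: A'_def)
    qed
    ultimately show ?thesis using X by auto
  qed
qed

theorem kneser_bound_set_mult:
  assumes "finite A" "finite B" "A \<subseteq> carrier G" "B \<subseteq> carrier G" "A \<noteq> {}" "B \<noteq> {}"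
  shows "kneser_bound (card A + card B) (A <#> B)"
proof -
  let ?m = "card A + card B"
  let ?F = "{X. X \<subseteq> A <#> B \<and> kneser_bound ?m X}"
  have fin: "finite (A <#> B)" using assms by (simp add: set_mult_def)
  have sub: "A <#> B \<subseteq> carrier G" using assms by (intro set_mult_closed)
  have cover: "\<exists>X\<in>?F. a \<otimes> b \<in> X" if "a \<in> A" "b \<in> B" for a b
    using kneser_bound_local[OF assms(1-4) that] by (simp add: Bex_def conj_ac)
  have "A <#> B \<subseteq> \<Union>?F"
  proof
    fix x assume "x \<in> A <#> B"
    then obtain a b where "a \<in> A" "b \<in> B" "x = a \<otimes> b" by (auto simp: set_mult_def)
    then show "x \<in> \<Union>?F" using cover[of a b] by (simp only: Union_iff)
  qed
  then have "\<Union>?F = A <#> B" by (intro equalityI) auto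
  moreover obtain a b where "a \<in> A" "b \<in> B" using assms(5,6) by blast
  then have "?F \<noteq> {}" using cover[of a b] by blast
  then have "kneser_bound ?m (\<Union>?F)"
  proof (rule kneser_bound_Union[rotated])
    show "finite ?F" using fin by (intro finite_subset[of ?F "Pow (A <#> B)"]) auto
    show "finite X \<and> X \<subseteq> carrier G \<and> kneser_bound ?m X" if "X \<in> ?F" for X
      using that sub finite_subset[OF _ fin, of X] by auto
  qed
  ultimately show ?thesis by simp
qed

section \<open>Deficiency\<close>

text \<open>Join \<open>a\<close> to those \<open>b\<close> in \<open>B\<close> with ab outside
  \<open>A\<close>. For \<open>S\<close> violating Hall's condition, \<open>U\<close> collects the
  elements of \<open>B\<close> joined to nothing in \<open>S\<close>. Conversely, a partial matching
  sends the part of its domain in \<open>S\<close> into \<open>B - U\<close>, so at least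
  \<open>card S - (card B - card U)\<close> elements of \<open>S\<close> stay unmatched.\<close>

lemma deficiency_less_iff:
  assumes "finite A" "finite B"
  shows "l < deficiency G A B \<longleftrightarrow>
    (\<exists>S U. S \<subseteq> A \<and> U \<subseteq> B \<and> S <#> U \<subseteq> A \<and> card B + l < card S + card U)"
proof
  assume l: "l < deficiency G A B"
  define N where "N a = {b \<in> B. a \<otimes> b \<notin> A}" for a
  have no: "\<not> (\<exists>D f. D \<subseteq> A \<and> card (A - D) \<le> l \<and> inj_on f D \<and> (\<forall>a\<in>D. f a \<in> N a))"
  proof safe
    fix D f assume "D \<subseteq> A" "card (A - D) \<le> l" "inj_on f D" "\<forall>a\<in>D. f a \<in> N a"
    then have "partial_matching G A B D f (card (A - D))"
      by (auto simp: partial_matching_def N_def)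
    then have "deficiency G A B \<le> card (A - D)"
      unfolding deficiency_def by (intro Least_le exI)
    then show False using l \<open>card (A - D) \<le> l\<close> by simp
  qed
  have finN: "finite (N a)" for a using assms by (simp add: N_def)
  have "\<not> (\<forall>S\<subseteq>A. card S \<le> card (\<Union>(N ` S)) + l)"
  proof
    assume "\<forall>S\<subseteq>A. card S \<le> card (\<Union>(N ` S)) + l"
    then have "\<exists>D f. D \<subseteq> A \<and> card (A - D) \<le> l \<and> inj_on f D \<and> (\<forall>a\<in>D. f a \<in> N a)"
      using \<open>finite A\<close> finN by (intro Hall_defect) auto
    then show False using no by (rule notE[rotated])
  qed
  then obtain S where S: "S \<subseteq> A" "card (\<Union>(N ` S)) + l < card S"
    unfolding not_all not_imp not_le by (elim exE conjE)
  define U where "U = B - \<Union>(N ` S)"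
  have sub: "\<Union>(N ` S) \<subseteq> B" by (auto simp: N_def)
  have "card U = card B - card (\<Union>(N ` S))"
    unfolding U_def by (rule card_Diff_subset[OF finite_subset[OF sub assms(2)] sub])
  moreover have "card (\<Union>(N ` S)) \<le> card B" by (rule card_mono[OF assms(2) sub])
  moreover have "S <#> U \<subseteq> A" by (auto simp: set_mult_def U_def N_def)
  moreover have "U \<subseteq> B" by (auto simp: U_def)
  moreover have "card B + l < card S + card U" using calculation(1,2) S(2) by linarith
  ultimately show "\<exists>S U. S \<subseteq> A \<and> U \<subseteq> B \<and> S <#> U \<subseteq> A \<and> card B + l < card S + card U"
    using S(1) by blast
next
  assume "\<exists>S U. S \<subseteq> A \<and> U \<subseteq> B \<and> S <#> U \<subseteq> A \<and> card B + l < card S + card U"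
  then obtain S U where SU: "S \<subseteq> A" "U \<subseteq> B" "S <#> U \<subseteq> A" "card B + l < card S + card U" by blast
  \<comment> \<open>The empty map shows that some defect occurs, so the least one is
    attained.\<close>
  have "\<exists>D f. partial_matching G A B D f (card A)"
    by (intro exI[of _ "{}"] exI[of _ id]) (simp add: partial_matching_def)
  then have "\<exists>D f. partial_matching G A B D f (deficiency G A B)"
    unfolding deficiency_def by (rule LeastI)
  then obtain D f where D: "D \<subseteq> A" "card (A - D) = deficiency G A B" "inj_on f D"
      "f ` D \<subseteq> B" "\<forall>a\<in>D. a \<otimes> f a \<notin> A"
    unfolding partial_matching_def by (elim exE conjE)
  have "f ` (D \<inter> S) \<subseteq> B - U"
  proof (rule image_subsetI)
    fix a assume a: "a \<in> D \<inter> S"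
    have "f a \<notin> U"
    proof
      assume "f a \<in> U"
      then have "a \<otimes> f a \<in> S <#> U" using a unfolding set_mult_def by blast
      then show False using a D(5) SU(3) by blast
    qed
    then show "f a \<in> B - U" using a D(4) by (simp add: image_subset_iff)
  qed
  then have "card (D \<inter> S) \<le> card (B - U)"
    using assms(2) by (intro card_inj_on_le[of f] inj_on_subset[OF D(3)]) simp_all
  also have "\<dots> = card B - card U" by (rule card_Diff_subset[OF finite_subset[OF SU(2) assms(2)] SU(2)])
  finally have 1: "card (D \<inter> S) \<le> card B - card U" .
  have "card S \<le> card ((D \<inter> S) \<union> (A - D))"
    using SU(1) finite_subset[OF D(1) assms(1)] assms(1) by (intro card_mono) auto
  also have "\<dots> \<le> card (D \<inter> S) + card (A - D)" by (rule card_Un_le)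
  finally show "l < deficiency G A B"
    using 1 D(2) SU(4) card_mono[OF assms(2) SU(2)] by linarith
qed

section \<open>The two directions of the equivalence\<close>

lemma ex_subgroup_if_deficiency:
  assumes "A \<subseteq> carrier G" "B \<subseteq> carrier G" "finite A" "finite B" "\<one> \<notin> B"
    and "card A = n" "card B = n" "l < deficiency G A B"
  shows "\<exists>H. subgroup H G \<and> finite H \<and> card H \<le> n \<and> (\<forall>j\<in>{1..l + 1}. \<not> card H dvd (n + j))"
proof -
  obtain S U where SU: "S \<subseteq> A" "U \<subseteq> B" "S <#> U \<subseteq> A" "n + l < card S + card U"
    using deficiency_less_iff[of A B l] assms by auto
  define V where "V = insert \<one> U"
  have fin: "finite S" "finite U" 
    using finite_subset[OF SU(1)] finite_subset[OF SU(2)] assms by simp_all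
  have "card U \<le> n" using card_mono[OF _ SU(2)] assms by simp
  then have ne: "S \<noteq> {}" using SU by auto
  have sub: "S \<subseteq> carrier G" "V \<subseteq> carrier G" using SU assms by (auto simp: V_def)
  \<comment> \<open>Adjoining the identity, which is not in \<open>B\<close>, gains the one unit
    that settles the case \<open>j = l + 1\<close>.\<close>
  have V: "card V = card U + 1" "finite V"
    using fin(2) subsetD[OF SU(2), of \<one>] assms(5) by (auto simp: V_def card_insert_if)
  let ?C = "S <#> V"
  have CA: "?C \<subseteq> A" using SU sub by (force simp: V_def set_mult_def subset_iff)
  then have C: "finite ?C" "card ?C \<le> n" "?C \<subseteq> carrier G"
    using assms card_mono[OF _ CA] finite_subset[OF CA] by auto
  obtain H where H: "subgroup H G" "finite H" "periodic ?C H" "card S + card V \<le> card ?C + card H"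
    using kneser_bound_set_mult[OF fin(1) V(2) sub ne] unfolding kneser_bound_def by (auto simp: V_def)
  have dvd: "card H dvd card ?C" using H C by (intro card_subgroup_dvd_periodic)
  have "?C \<noteq> {}" using ne by (auto simp: V_def set_mult_def)
  then have "card ?C > 0" using C by auto
  then have "card H \<le> n" using dvd C by (meson dvd_imp_le le_trans)
  moreover have "\<not> card H dvd (n + j)" if "j \<in> {1..l + 1}" for j
  proof
    assume "card H dvd n + j"
    \<comment> \<open>Distinct multiples of \<open>card H\<close> differ by at least
      \<open>card H\<close>, whereas Kneser's bound gives
      \<open>card H \<ge> n + l + 2 - card ?C\<close>.\<close>
    then have "card H dvd (n + j - card ?C)" using dvd by (rule dvd_diff_nat)
    then have "card H \<le> n + j - card ?C" using that C by (intro dvd_imp_le) auto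
    moreover have "j \<le> l + 1" using that by simp
    ultimately show False using H(4) SU(4) V(1) C(2) by linarith
  qed
  ultimately show ?thesis using H(1,2) by (intro exI[of _ H]) simp
qed

lemma ex_periodic_card:
  assumes H: "subgroup H G" "finite H" and "infinite (carrier G) \<or> q * card H \<le> card (carrier G)"
  shows "\<exists>X. X \<subseteq> carrier G \<and> finite X \<and> periodic X H \<and> card X = q * card H"
  using assms(3)
proof (induction q)
  case 0
  show ?case by (intro exI[of _ "{}"]) (auto simp: periodic_def)
next
  case (Suc q)
  interpret subgroup H G by fact
  obtain X where X: "X \<subseteq> carrier G" "finite X" "periodic X H" "card X = q * card H"
    using Suc by fastforce
  have "card H > 0" using H(2) one_closed unfolding card_gt_0_iff by blast
  \<comment> \<open>By assumption a finite group has room for \<open>Suc q\<close> cosets, and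
    \<open>X\<close> fills only \<open>q\<close> of them.\<close>
  then have "X \<noteq> carrier G" using X Suc.prems by auto
  then obtain x where x: "x \<in> carrier G" "x \<notin> X" using X by blast
  let ?Y = "(\<otimes>) x ` H"
  have "card ?Y = card H" using x by (intro card_image inj_onI) auto
  moreover have "X \<inter> ?Y = {}" using periodic_mult_iff[OF H(1) X(3)] x by auto
  ultimately have "card (X \<union> ?Y) = Suc q * card H"
    using X H by (simp add: card_Un_disjoint)
  moreover have "periodic (X \<union> ?Y) H"
    using X x by (auto simp: periodic_def m_assoc)
  ultimately show ?case using X x H by (intro exI[of _ "X \<union> ?Y"]) auto
qed

lemma ex_deficient_if_subgroup:
  assumes H: "subgroup H G" "finite H" "card H \<le> n" "\<forall>j\<in>{1..l + 1}. \<not> card H dvd (n + j)"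
    and n: "infinite (carrier G) \<or> n < card (carrier G)"
  shows "\<exists>A B. A \<subseteq> carrier G \<and> B \<subseteq> carrier G \<and> finite A \<and> finite B \<and> \<one> \<notin> B \<and>
    card A = n \<and> card B = n \<and> l < deficiency G A B"
proof -
  interpret subgroup H G by fact
  have pos: "card H > 0" using H(2) one_closed unfolding card_gt_0_iff by blast
  define q where "q = n div card H"
  have qr: "n = q * card H + n mod card H" by (simp add: q_def)
  \<comment> \<open>The first multiple of \<open>card H\<close> above \<open>n\<close> is
    \<open>n + (card H - n mod card H)\<close>; by hypothesis it exceeds
    \<open>n + l + 1\<close>.\<close>
  have r: "n mod card H + l + 1 < card H"
  proof (rule ccontr)
    assume "\<not> ?thesis"
    moreover have "n mod card H < card H" using pos by simp
    ultimately have "card H - n mod card H \<in> {1..l + 1}" by auto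
    moreover have "n + (card H - n mod card H) = (q + 1) * card H"
      using qr \<open>n mod card H < card H\<close> by (simp add: algebra_simps)
    ultimately show False using H(4) by (metis dvd_triv_right)
  qed
  have "infinite (carrier G) \<or> q * card H \<le> card (carrier G)" using n qr by linarith
  then obtain S where S: "S \<subseteq> carrier G" "finite S" "periodic S H" "card S = q * card H"
    using ex_periodic_card[OF H(1,2), of q] by meson
  define U where "U = H - {\<one>}"
  have U: "U \<subseteq> carrier G - {\<one>}" "finite U" "card U = card H - 1"
    using H by (auto simp: U_def)
  have "card S \<le> n" "infinite (carrier G) \<or> n \<le> card (carrier G)" using S n qr by linarith+
  from ex_superset_card[OF S(1,2) this] obtain A
    where A: "S \<subseteq> A" "A \<subseteq> carrier G" "finite A" "card A = n" by (elim exE conjE)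
  \<comment> \<open>The strict bound \<open>n < card (carrier G)\<close> leaves room for
    \<open>n\<close> elements besides the identity.\<close>
  have "card U \<le> n" "infinite (carrier G - {\<one>}) \<or> n \<le> card (carrier G - {\<one>})"
    using n U(3) H(3) by auto
  from ex_superset_card[OF U(1,2) this] obtain B
    where B: "U \<subseteq> B" "B \<subseteq> carrier G - {\<one>}" "finite B" "card B = n" by (elim exE conjE)
  have "S <#> U \<subseteq> A" using S A by (auto simp: periodic_def U_def set_mult_def)
  \<comment> \<open>The left-out remainder of \<open>n\<close> costs \<open>n mod card H\<close>,
    while \<open>U\<close> contributes \<open>card H - 1\<close>; the inequality \<open>r\<close>
    compares the two.\<close>
  moreover have "n + l < card S + card U" using S(4) U(3) qr r by linarith
  ultimately have "l < deficiency G A B"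
    unfolding deficiency_less_iff[OF A(3) B(3)] B(4)
    using A(1) B(1) by (intro exI[of _ S] exI[of _ U] conjI)
  then show ?thesis using A B by (intro exI[of _ A] exI[of _ B]) auto
qed

end

theorem theorem4p3:
  fixes G :: "('a, 'b) monoid_scheme" and l n :: nat
  assumes "comm_group G"
    and "\<exists>H. finite_nontrivial_proper_subgroup H G"
    and "n0 G \<le> n"
    and "infinite (carrier G) \<or> n < card (carrier G)"
  shows "(\<exists>A B. A \<subseteq> carrier G \<and> B \<subseteq> carrier G \<and> finite A \<and> finite B \<and> \<one>\<^bsub>G\<^esub> \<notin> B \<and>
            card A = n \<and> card B = n \<and> deficiency G A B > l)
     \<longleftrightarrow> (\<exists>H. subgroup H G \<and> finite H \<and> card H \<le> n \<and>
            (\<forall>j\<in>{1..l + 1}. \<not> card H dvd (n + j)))"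
proof -
  interpret comm_group G by fact
  show ?thesis (is "?L \<longleftrightarrow> ?R")
  proof
    assume ?L
    then show ?R by (elim exE conjE) (rule ex_subgroup_if_deficiency)
  next
    assume ?R
    then show ?L by (elim exE conjE) (rule ex_deficient_if_subgroup[OF _ _ _ _ assms(4)])
  qed
qed

end
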